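(* Let $E$ be a normed lattice, $F$ a vector lattice, and let $A,C\subseteq\mathrm{L}_+(E,F)$ be such that $A$ is dominated by $C$. If $C$ is collectively quasi-$\sigma$-Levi, then $A$ is also collectively quasi-$\sigma$-Levi.
   Context: Vector spaces are real and operators are linear; $\mathrm{L}(E,F)$ is the space of linear operators from $E$ to $F$, and $\mathrm{L}_+(E,F)$ is the set of positive operators in it. For operators $S,T$, $S\le T$ means that $T-S$ is positive. For a sequence $(p_n)$ in a vector lattice, $p_n\downarrow 0$ means that $p_{n'}\le p_n$ for all $n'\ge n$ and $\inf_n p_n=0$. For $A,B\subseteq\mathrm{L}_+(E,F)$, the set $A$ is dominated by $B$ if for each $S\in A$ there exists $T\in B$ with $S\le T$. A set $A\subseteq \mathrm{L}(E,F)$, with $E$ a normed lattice and $F$ a vector lattice, is collectively quasi-$\sigma$-Levi if for every increasing norm-bounded sequence $(x_n)$ in $E_+$ there exists a sequence $p_n\downarrow 0$ in $F$ such that $|Tx_{n'}-Tx_{n''}|\le p_n$ for all $T\in A$ and all $n,n',n''$ with $n',n''\ge n$. *)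

theory Defs
  imports Complex_Main "HOL-Library.Lattice_Algebras" "HOL-Library.Lub_Glb"
begin

class vector_lattice = ordered_real_vector + lattice_ab_group_add_abs

class normed_lattice = vector_lattice + real_normed_vector +
  assumes norm_mono_abs: "\<bar>x\<bar> \<le> \<bar>y\<bar> \<Longrightarrow> norm x \<le> norm y"

instance real :: vector_lattice ..

instance real :: normed_lattice
  by standard simp

definition positive_operators ::
    "('a::ordered_real_vector \<Rightarrow> 'b::ordered_real_vector) set" where
  "positive_operators = {T. linear T \<and> (\<forall>x\<ge>0. 0 \<le> T x)}"

text \<open>The order of the operator space is not the pointwise order that the library
  puts on the function type: the latter compares the values at all vectors, not only at
  the positive ones.\<close>

definition operator_le ::
    "('a::ordered_real_vector \<Rightarrow> 'b::ordered_real_vector) \<Rightarrow> ('a \<Rightarrow> 'b) \<Rightarrow> bool" where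
  "operator_le S T \<longleftrightarrow> (\<lambda>x. T x - S x) \<in> positive_operators"

definition dominated_by ::
    "('a::ordered_real_vector \<Rightarrow> 'b::ordered_real_vector) set \<Rightarrow> ('a \<Rightarrow> 'b) set \<Rightarrow> bool" where
  "dominated_by A B \<longleftrightarrow> (\<forall>S\<in>A. \<exists>T\<in>B. operator_le S T)"

definition decreases_to_zero :: "(nat \<Rightarrow> 'b::vector_lattice) \<Rightarrow> bool" where
  "decreases_to_zero p \<longleftrightarrow> decseq p \<and> isGlb UNIV (range p) 0"

definition collectively_quasi_sigma_Levi ::
    "('a::normed_lattice \<Rightarrow> 'b::vector_lattice) set \<Rightarrow> bool" where
  "collectively_quasi_sigma_Levi A \<longleftrightarrow>
    (\<forall>x :: nat \<Rightarrow> 'a. incseq x \<longrightarrow> (\<forall>n. 0 \<le> x n) \<longrightarrow> Bseq x \<longrightarrow>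
      (\<exists>p. decreases_to_zero p \<and>
        (\<forall>T\<in>A. \<forall>n n' n''. n \<le> n' \<longrightarrow> n \<le> n'' \<longrightarrow> \<bar>T (x n') - T (x n'')\<bar> \<le> p n)))"

end

theory Submission
  imports Defs
begin

text \<open>If \<open>S\<close> and \<open>T - S\<close> are both positive, then for
  \<open>u \<le> v\<close> the increments satisfy \<open>0 \<le> S v - S u \<le> T v - T u\<close>
  (\<open>abs_diff_le_dominating\<close>). The terms of an increasing sequence are pairwise
  comparable, so oscillations of \<open>S\<close> along it are bounded by those of any dominating
  \<open>T\<close>. Hence the sequence \<open>p\<close> that witnesses the property for
  \<open>C\<close> also serves for \<open>A\<close>.\<close>

lemma positive_operator_mono:
  assumes "T \<in> positive_operators" "u \<le> v"
  shows "T u \<le> T v"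
proof -
  have "0 \<le> T (v - u)"
    using assms by (simp add: positive_operators_def)
  also have "T (v - u) = T v - T u"
    using assms by (simp add: positive_operators_def linear_diff)
  finally show ?thesis
    by (simp only: diff_ge_0_iff_ge)
qed

text \<open>Both \<open>S\<close> and \<open>T - S\<close> are monotone, being positive.
  Comparability of \<open>u\<close> and \<open>v\<close> is essential: on a vector \<open>w\<close>
  of mixed sign, \<open>S \<le> T\<close> does not give
  \<open>\<bar>S w\<bar> \<le> \<bar>T w\<bar>\<close>.\<close>

lemma abs_diff_le_dominating:
  fixes S T :: "'a::ordered_real_vector \<Rightarrow> 'b::vector_lattice"
  assumes "S \<in> positive_operators" "operator_le S T" "u \<le> v"
  shows "\<bar>S v - S u\<bar> \<le> \<bar>T v - T u\<bar>"
proof -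
  have "\<bar>S v - S u\<bar> = S v - S u"
    using positive_operator_mono[OF assms(1,3)] by (simp only: abs_of_nonneg diff_ge_0_iff_ge)
  also have "\<dots> \<le> T v - T u"
    using positive_operator_mono[OF assms(2)[unfolded operator_le_def] assms(3)]
    by (simp only: algebra_simps)
  also have "\<dots> \<le> \<bar>T v - T u\<bar>"
    by (rule abs_ge_self)
  finally show ?thesis .
qed

theorem theorem3:
  fixes A C :: "('a::normed_lattice \<Rightarrow> 'b::vector_lattice) set"
  assumes "A \<subseteq> positive_operators"
    and "C \<subseteq> positive_operators"
    and "dominated_by A C"
    and "collectively_quasi_sigma_Levi C"
  shows "collectively_quasi_sigma_Levi A"
  unfolding collectively_quasi_sigma_Levi_def
proof (intro allI impI)
  fix x :: "nat \<Rightarrow> 'a"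
  assume x: "incseq x" "\<forall>n. 0 \<le> x n" "Bseq x"
  obtain p where p: "decreases_to_zero p"
    and Cp: "\<forall>T\<in>C. \<forall>n n' n''. n \<le> n' \<longrightarrow> n \<le> n'' \<longrightarrow> \<bar>T (x n') - T (x n'')\<bar> \<le> p n"
    using assms(4)[unfolded collectively_quasi_sigma_Levi_def,
        THEN spec, THEN mp, OF x(1), THEN mp, OF x(2), THEN mp, OF x(3)]
    by (elim exE conjE)
  have "\<bar>S (x n') - S (x n'')\<bar> \<le> p n" if S: "S \<in> A" and n: "n \<le> n'" "n \<le> n''" for S n n' n''
  proof -
    \<comment> \<open>The dominating \<open>T\<close> varies with \<open>S\<close>, but
      \<open>p\<close> was fixed beforehand and bounds all of \<open>C\<close> uniformly.\<close>
    obtain T where T: "T \<in> C" "operator_le S T"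
      using assms(3) S unfolding dominated_by_def by blast
    have "S \<in> positive_operators"
      using assms(1) S by blast
    note dom = abs_diff_le_dominating[OF this T(2)]
    have "\<bar>S (x n') - S (x n'')\<bar> \<le> \<bar>T (x n') - T (x n'')\<bar>"
    \<comment> \<open>The indices come in either order; \<open>dom\<close> needs the smaller vector
      first, and symmetry of \<open>\<bar>a - b\<bar>\<close> covers the other case.\<close>
    proof (cases "n'' \<le> n'")
      case True
      then show ?thesis
        by (intro dom incseqD[OF x(1)])
    next
      case False
      then have "\<bar>S (x n'') - S (x n')\<bar> \<le> \<bar>T (x n'') - T (x n')\<bar>"
        by (intro dom incseqD[OF x(1)]) simp
      then show ?thesis
        by (simp only: abs_minus_commute)
    qed
    also have "\<dots> \<le> p n"
      by (rule Cp[rule_format, OF T(1) n])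
    finally show ?thesis .
  qed
  then show "\<exists>p. decreases_to_zero p \<and>
      (\<forall>T\<in>A. \<forall>n n' n''. n \<le> n' \<longrightarrow> n \<le> n'' \<longrightarrow> \<bar>T (x n') - T (x n'')\<bar> \<le> p n)"
    by (intro exI[of _ p] conjI p ballI allI impI)
qed

end
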